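(* Let $N$ be a positive integer and let $P,p,Q,q,R,a,b,c,k,y,z$ be complex numbers such that none of the denominators below vanish. Then $$\sum_{n=0}^{N}\frac{\left(q\sqrt{k},-q\sqrt{k},y,z,\frac{k^2q^{N}}{yz},q^{-N};q\right)_n}{\left(\sqrt{k},-\sqrt{k},\frac{qk}{y},\frac{qk}{z},\frac{yzq^{1-N}}{k},kq^{1+N};q\right)_n}\cdot\frac{(ap^2;p^2)_n(bP^2;P^2)_n(cR^2;R^2)_n\left(\frac{aQ^2}{bc};Q^2\right)_n\,q^n}{\left(\frac{PQR}{p};\frac{PQR}{p}\right)_n\left(\frac{apPQ}{cR};\frac{pPQ}{R}\right)_n\left(\frac{apQR}{bP};\frac{pQR}{P}\right)_n\left(\frac{bcpPR}{Q};\frac{pPR}{Q}\right)_n}$$ $$=\frac{\left(1-\frac{k}{y}\right)\left(1-\frac{k}{z}\right)(1-kq^N)\left(1-\frac{kq^N}{yz}\right)}{(1-k)\left(1-\frac{k}{yz}\right)\left(1-\frac{kq^N}{y}\right)\left(1-\frac{kq^N}{z}\right)}\sum_{n=0}^{N}\frac{\left(y,z,\frac{k^2q^{N}}{yz},q^{-N};q\right)_{n}}{\left(\frac{k}{y},\frac{k}{z},kq^{N},\frac{yzq^{-N}}{k};q\right)_{n}}$$ $$\times\frac{\left(1-ap^nP^nQ^nR^n\right)\left(1-b\frac{p^nP^n}{Q^nR^n}\right)\left(1-\frac{P^nQ^n}{cp^nR^n}\right)\left(1-\frac{ap^nQ^n}{bcP^nR^n}\right)}{(1-a)(1-b)\left(1-\frac1c\right)\left(1-\frac{a}{bc}\right)}$$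 $$\times\frac{(a;p^2)_n(b;P^2)_n(c;R^2)_n\left(\frac{a}{bc};Q^2\right)_n R^{2n}}{\left(\frac{PQR}{p};\frac{PQR}{p}\right)_n\left(\frac{apPQ}{cR};\frac{pPQ}{R}\right)_n\left(\frac{apQR}{bP};\frac{pQR}{P}\right)_n\left(\frac{bcpPR}{Q};\frac{pPR}{Q}\right)_n};$$ and, for $m$ an integer, $$\sum_{n=0}^{N}\frac{\left(q\sqrt{k},-q\sqrt{k},y,z,\frac{k^2q^{N}}{yz},q^{-N};q\right)_n}{\left(\sqrt{k},-\sqrt{k},\frac{qk}{y},\frac{qk}{z},\frac{yzq^{1-N}}{k},kq^{1+N};q\right)_n}\cdot\frac{\left(aq^m,bq^m,cq^m,\frac{aq^m}{bc};q^m\right)_n}{\left(\frac{a}{c}q^m,\frac{a}{b}q^m,bcq^m,q^m;q^m\right)_n}\,q^{n}$$ $$=\frac{\left(1-\frac{k}{y}\right)\left(1-\frac{k}{z}\right)(1-kq^N)\left(1-\frac{kq^N}{yz}\right)}{(1-k)\left(1-\frac{k}{yz}\right)\left(1-\frac{kq^N}{y}\right)\left(1-\frac{kq^N}{z}\right)}\sum_{n=0}^{N}\frac{\left(y,z,\frac{k^2q^{N}}{yz},q^{-N};q\right)_{n}}{\left(\frac{k}{y},\frac{k}{z},kq^{N},\frac{yzq^{-N}}{k};q\right)_{n}}\cdot\frac{\left(q^m\sqrt{a},-q^m\sqrt{a},a,b,c,\frac{a}{bc};q^m\right)_n q^{mn}}{\left(\sqrt{a},-\sqrt{a},\frac{a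}{c}q^m,\frac{a}{b}q^m,bcq^m,q^m;q^m\right)_n}.$$
   Context: For an integer $n\ge 0$ and any base $t$, $(x;t)_n=\prod_{i=0}^{n-1}(1-xt^i)$ and $(x_1,\dots,x_r;t)_n=\prod_{j=1}^r(x_j;t)_n$. $\sqrt k$ and $\sqrt a$ denote fixed square roots. The nonvanishing of denominators includes that every quantity by which one divides is nonzero (in particular $q$, which occurs as $q^{-N}$). *)

theory Defs
  imports Complex_Main
begin

definition qpoch :: "complex \<Rightarrow> complex \<Rightarrow> nat \<Rightarrow> complex" where
  "qpoch x t n = (\<Prod>i<n. (1 - x * t ^ i))"

definition qpochs :: "complex list \<Rightarrow> complex \<Rightarrow> nat \<Rightarrow> complex" where
  "qpochs xs t n = (\<Prod>x\<leftarrow>xs. qpoch x t n)"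

end

theory Submission
  imports Defs
begin

text \<open>
  Both sides arise from one summation by parts. Let \<open>B n\<close> be the part of the left summand that
  involves \<open>a, b, c\<close> (without \<open>q\<^sup>n\<close>) and \<open>\<beta> n\<close> the corresponding part on the right. Then
  \<open>B n = \<beta> 0 + ... + \<beta> n\<close>: this is Gasper's indefinite quadribasic summation, and its one-base
  case. Since the four parameters \<open>y, z, k\<^sup>2 q^N / (y z), q^(-N)\<close> have product \<open>k\<^sup>2\<close>, the
  very-well-poised factor on the left, times \<open>q\<^sup>n\<close>, is a constant multiple of \<open>V n - V (n + 1)\<close>,
  where \<open>V n\<close> is the well-poised factor on the right. The boundary term vanishes because
  \<open>V (N + 1)\<close> contains the factor \<open>1 - q^(-N) q^N = 0\<close>.
\<close>

section \<open>Shifted factorials and their ratios\<close>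

lemma qpoch_0 [simp]: "qpoch x t 0 = 1"
  by (simp add: qpoch_def)

lemma qpoch_Suc: "qpoch x t (Suc n) = qpoch x t n * (1 - x * t ^ n)"
  by (simp add: qpoch_def)

lemma qpoch_Suc_left: "qpoch x t (Suc n) = (1 - x) * qpoch (x * t) t n"
  unfolding qpoch_def by (subst prod.lessThan_Suc_shift) (simp add: mult.assoc)

text \<open>The product of length \<open>Suc n\<close> can be split at its first or at its last
  factor; comparing both splittings gives the ratio.\<close>

lemma qpoch_shift_ratio:
  assumes "1 - x \<noteq> 0" "qpoch x t n \<noteq> 0"
  shows "qpoch (t * x) t n / qpoch x t n = (1 - x * t ^ n) / (1 - x)"
proof -
  have "(1 - x) * qpoch (t * x) t n = qpoch x t n * (1 - x * t ^ n)"
    by (metis qpoch_Suc qpoch_Suc_left mult.commute)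
  then show ?thesis
    using assms by (simp add: frac_eq_eq mult.commute)
qed

lemma qpochs_Nil [simp]: "qpochs [] t n = 1"
  by (simp add: qpochs_def)

lemma qpochs_Cons [simp]: "qpochs (x # xs) t n = qpoch x t n * qpochs xs t n"
  by (simp add: qpochs_def)

text \<open>Collapses the pair of square-root parameters to one rational factor free of
  \<open>s\<close>, because \<open>(1 - s) * (1 + s) = 1 - k\<close>. It serves \<open>k\<close> in
  base \<open>q\<close> and \<open>a\<close> in the base of the second formula.\<close>

lemma qpoch_sqrt_ratio:
  assumes "s ^ 2 = k" "1 - k \<noteq> 0" "qpoch s t n \<noteq> 0" "qpoch (- s) t n \<noteq> 0"
  shows "qpoch (t * s) t n * qpoch (- t * s) t n / (qpoch s t n * qpoch (- s) t n)
    = (1 - k * t ^ (2 * n)) / (1 - k)"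
proof -
  have k: "1 - k = (1 - s) * (1 - - s)"
    by (simp add: assms(1)[symmetric] power2_eq_square algebra_simps)
  have "qpoch (t * s) t n / qpoch s t n * (qpoch (t * - s) t n / qpoch (- s) t n)
    = (1 - s * t ^ n) / (1 - s) * ((1 - - s * t ^ n) / (1 - - s))"
    using assms k by (subst (1 2) qpoch_shift_ratio) auto
  also have "(1 - s * t ^ n) / (1 - s) * ((1 - - s * t ^ n) / (1 - - s))
    = ((1 - s * t ^ n) * (1 - - s * t ^ n)) / (1 - k)"
    by (simp only: k times_divide_times_eq)
  also have "(1 - s * t ^ n) * (1 - - s * t ^ n) = 1 - k * t ^ (2 * n)"
    by (simp add: assms(1)[symmetric] power2_eq_square algebra_simps mult_2 power_add power_mult power_mult_distrib)
  finally show ?thesis by simp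
qed

section \<open>Abel summation\<close>

lemma summation_by_parts:
  fixes C :: "'a::comm_ring_1"
  assumes "\<And>n. n \<le> N \<Longrightarrow> u n = C * (V n - V (Suc n))"
    and "B 0 = \<beta> 0" and "\<And>n. n < N \<Longrightarrow> B (Suc n) = B n + \<beta> (Suc n)"
    and "V (Suc N) = 0"
  shows "(\<Sum>n=0..N. u n * B n) = C * (\<Sum>n=0..N. V n * \<beta> n)"
proof -
  \<comment> \<open>Partial sums carry the boundary term \<open>V (Suc M) * B M\<close>, which has
    to vanish only at the end, \<open>M = N\<close>.\<close>
  have "(\<Sum>n=0..M. u n * B n) = C * ((\<Sum>n=0..M. V n * \<beta> n) - V (Suc M) * B M)" if "M \<le> N" for M
    using that by (induction M) (simp_all add: assms algebra_simps)
  from this[of N] show ?thesis by (simp add: assms(4))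
qed

section \<open>Telescoping of well-poised quotients\<close>

text \<open>Compare the elementary symmetric functions of the \<open>x\<close>s and of the
  \<open>k / x\<close>s: the balance condition makes those of degree 2 and 4 agree, and turns degree
  3 of either family into \<open>k\<close> times degree 1 of the other. Only the terms in
  \<open>s\<close> and \<open>s ^ 3\<close> survive.\<close>

lemma well_poised_factor_diff:
  fixes k s :: "'a::field"
  assumes "x1 * x2 * x3 * x4 = k ^ 2" "k \<noteq> 0"
  shows "(1 - k / x1 * s) * (1 - k / x2 * s) * (1 - k / x3 * s) * (1 - k / x4 * s)
      - (1 - x1 * s) * (1 - x2 * s) * (1 - x3 * s) * (1 - x4 * s)
    = s * (1 - k * s ^ 2) * (x1 + x2 + x3 + x4 - k / x1 - k / x2 - k / x3 - k / x4)"
proof -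
  define w1 w2 w3 w4 where w: "w1 = k / x1" "w2 = k / x2" "w3 = k / x3" "w4 = k / x4"
  have nz: "x1 \<noteq> 0" "x2 \<noteq> 0" "x3 \<noteq> 0" "x4 \<noteq> 0" using assms by auto
  have xw: "x1 * w1 = k" "x2 * w2 = k" "x3 * w3 = k" "x4 * w4 = k" using nz w by auto
  \<comment> \<open>A product of two \<open>w\<close>s is \<open>k ^ 2\<close> over two
    \<open>x\<close>s, hence the product of the two complementary \<open>x\<close>s.\<close>
  have pair: "w1 * w2 = x3 * x4" "w3 * w4 = x1 * x2" "w1 * w3 = x2 * x4" "w2 * w4 = x1 * x3"
      "w1 * w4 = x2 * x3" "w2 * w3 = x1 * x4"
    using assms(1) nz by (simp_all add: w field_simps power2_eq_square)
  have e4: "w1 * w2 * w3 * w4 = k ^ 2"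
    using pair(1,2) assms(1) by (metis mult.assoc mult.commute)
  have e3: "w1 * w2 * w3 = k * x4" "w1 * w2 * w4 = k * x3" "w1 * w3 * w4 = k * x2" "w2 * w3 * w4 = k * x1"
    using pair xw by (metis mult.assoc mult.commute)+
  have f3: "x1 * x2 * x3 = k * w4" "x1 * x2 * x4 = k * w3" "x1 * x3 * x4 = k * w2" "x2 * x3 * x4 = k * w1"
    using pair xw by (metis mult.assoc mult.commute)+
  have expand: "(1 - a * s) * (1 - b * s) * (1 - c * s) * (1 - d * s)
    = 1 - (a + b + c + d) * s + (a*b + a*c + a*d + b*c + b*d + c*d) * s^2
      - (a*b*c + a*b*d + a*c*d + b*c*d) * s^3 + a*b*c*d * s^4" for a b c d
    by (simp add: algebra_simps power2_eq_square power3_eq_cube power4_eq_xxxx)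
  show ?thesis
    unfolding w[symmetric] expand unfolding e4 assms(1) unfolding e3 f3 unfolding pair
    by (simp add: algebra_simps power2_eq_square power3_eq_cube)
qed

text \<open>Over a common denominator, \<open>V n - V (Suc n)\<close> has the factor
  \<open>f - g\<close>, which is the preceding difference at \<open>s = q ^ n\<close>. The constant
  \<open>E\<close> does not depend on \<open>n\<close>, so it can be divided out.\<close>

lemma well_poised_telescope:
  fixes k q :: complex
  assumes "x1 * x2 * x3 * x4 = k ^ 2" "k \<noteq> 0" "1 - k \<noteq> 0"
    and E: "E = x1 + x2 + x3 + x4 - k / x1 - k / x2 - k / x3 - k / x4" "E \<noteq> 0"
    and den: "qpoch (k / x1) q (Suc n) \<noteq> 0" "qpoch (k / x2) q (Suc n) \<noteq> 0"
      "qpoch (k / x3) q (Suc n) \<noteq> 0" "qpoch (k / x4) q (Suc n) \<noteq> 0"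
  defines "V \<equiv> \<lambda>n. qpochs [x1, x2, x3, x4] q n / qpochs [k / x1, k / x2, k / x3, k / x4] q n"
  shows "(1 - k * q ^ (2 * n)) / (1 - k) * q ^ n * qpochs [x1, x2, x3, x4] q n
      / qpochs [k / x1 * q, k / x2 * q, k / x3 * q, k / x4 * q] q n
    = (1 - k / x1) * (1 - k / x2) * (1 - k / x3) * (1 - k / x4) / ((1 - k) * E) * (V n - V (Suc n))"
proof -
  define X where "X = qpochs [x1, x2, x3, x4] q n"
  define D where "D = qpochs [k / x1, k / x2, k / x3, k / x4] q n"
  define S where "S = qpochs [k / x1 * q, k / x2 * q, k / x3 * q, k / x4 * q] q n"
  define d where "d = (1 - k / x1) * (1 - k / x2) * (1 - k / x3) * (1 - k / x4)"
  define f where "f = (1 - k / x1 * q ^ n) * (1 - k / x2 * q ^ n) * (1 - k / x3 * q ^ n) * (1 - k / x4 * q ^ n)"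
  define g where "g = (1 - x1 * q ^ n) * (1 - x2 * q ^ n) * (1 - x3 * q ^ n) * (1 - x4 * q ^ n)"
  \<comment> \<open>Both sides are the product of the \<open>k / xi\<close> factorials of length
    \<open>Suc n\<close>. This trades the denominators shifted by \<open>q\<close> for those of
    \<open>V\<close>.\<close>
  have dS: "d * S = D * f"
  proof -
    have "(1 - k / x) * qpoch (k / x * q) q n = qpoch (k / x) q n * (1 - k / x * q ^ n)" for x
      using qpoch_Suc qpoch_Suc_left by metis
    note r = this[of x1] this[of x2] this[of x3] this[of x4]
    have "d * S = ((1 - k / x1) * qpoch (k / x1 * q) q n) * ((1 - k / x2) * qpoch (k / x2 * q) q n)
      * ((1 - k / x3) * qpoch (k / x3 * q) q n) * ((1 - k / x4) * qpoch (k / x4 * q) q n)"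
      by (simp add: d_def S_def)
    also have "\<dots> = D * f" unfolding r by (simp add: D_def f_def)
    finally show ?thesis .
  qed
  have V: "V n = X / D" "V (Suc n) = X * g / (D * f)"
    unfolding V_def X_def D_def g_def f_def by (simp_all add: qpoch_Suc mult_ac)
  have nz: "D \<noteq> 0" "f \<noteq> 0" using den by (simp_all add: D_def f_def qpoch_Suc)
  have nz': "d \<noteq> 0" "S \<noteq> 0" using dS nz by auto
  have fg: "f - g = q ^ n * (1 - k * q ^ (2 * n)) * E"
    unfolding f_def g_def E(1) well_poised_factor_diff[OF assms(1,2)]
    by (simp add: power_mult[symmetric] mult.commute)
  have "d / ((1 - k) * E) * (V n - V (Suc n)) = d * X * (f - g) / ((1 - k) * E * (D * f))"
    using nz assms(3) E(2) by (simp add: V field_simps)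
  also have "\<dots> = d * X * (q ^ n * (1 - k * q ^ (2 * n)) * E) / ((1 - k) * E * (d * S))"
    using fg dS by simp
  also have "\<dots> = (1 - k * q ^ (2 * n)) / (1 - k) * q ^ n * X / S"
    using nz' E(2) by simp
  finally show ?thesis unfolding X_def S_def d_def by (rule sym)
qed

section \<open>Indefinite summation with four bases and with one\<close>

text \<open>The algebraic core of one summation step, with \<open>X, Y, Z, W\<close> standing for
  the powers of \<open>p, P, Q, R\<close>. These powers can be treated as free variables: clearing
  denominators leaves a polynomial identity.\<close>

lemma quadribasic_identity:
  fixes a b c X Y Z W :: "'a::field"
  assumes "X \<noteq> 0" "Y \<noteq> 0" "Z \<noteq> 0" "W \<noteq> 0" "b \<noteq> 0" "c \<noteq> 0"
  shows "(1 - a * X ^ 2) * (1 - b * Y ^ 2) * (1 - c * W ^ 2) * (1 - a / (b * c) * Z ^ 2)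
     - (1 - Y * Z * W / X) * (1 - a / c * (X * Y * Z / W)) * (1 - a / b * (X * Z * W / Y)) * (1 - b * c * (X * Y * W / Z))
    = - c * W ^ 2 * ((1 - a * X * Y * Z * W) * (1 - b * (X * Y / (Z * W))) * (1 - Y * Z / (c * X * W)) * (1 - a * X * Z / (b * c * Y * W)))"
  using assms by (simp add: field_simps) algebra

text \<open>Passing from \<open>n\<close> to \<open>Suc n\<close> multiplies \<open>B n\<close> by
  \<open>g / e\<close>, so the increment is proportional to \<open>g - e\<close>, which the
  preceding identity factors.\<close>

lemma quadribasic_step:
  fixes a b c p P Q R :: complex
  assumes nz: "p \<noteq> 0" "P \<noteq> 0" "Q \<noteq> 0" "R \<noteq> 0" "b \<noteq> 0" "c \<noteq> 0"
    and pre: "(1 - a) * (1 - b) * (1 - 1 / c) * (1 - a / (b * c)) \<noteq> 0"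
  defines "D \<equiv> \<lambda>n. qpoch (P * Q * R / p) (P * Q * R / p) n
                * qpoch (a * p * P * Q / (c * R)) (p * P * Q / R) n
                * qpoch (a * p * Q * R / (b * P)) (p * Q * R / P) n
                * qpoch (b * c * p * P * R / Q) (p * P * R / Q) n"
  assumes den: "D (Suc n) \<noteq> 0"
  defines "B \<equiv> \<lambda>n. qpoch (a * p ^ 2) (p ^ 2) n * qpoch (b * P ^ 2) (P ^ 2) n
             * qpoch (c * R ^ 2) (R ^ 2) n * qpoch (a * Q ^ 2 / (b * c)) (Q ^ 2) n / D n"
  defines "\<beta> \<equiv> \<lambda>n. ((1 - a * p ^ n * P ^ n * Q ^ n * R ^ n)
             * (1 - b * (p ^ n * P ^ n / (Q ^ n * R ^ n)))
             * (1 - P ^ n * Q ^ n / (c * p ^ n * R ^ n))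
             * (1 - a * p ^ n * Q ^ n / (b * c * P ^ n * R ^ n))
             / ((1 - a) * (1 - b) * (1 - 1 / c) * (1 - a / (b * c))))
          * (qpoch a (p ^ 2) n * qpoch b (P ^ 2) n
             * qpoch c (R ^ 2) n * qpoch (a / (b * c)) (Q ^ 2) n * R ^ (2 * n) / D n)"
  shows "B (Suc n) = B n + \<beta> (Suc n)"
proof -
  let ?m = "Suc n"
  define X Y Z W where XYZW: "X = p ^ ?m" "Y = P ^ ?m" "Z = Q ^ ?m" "W = R ^ ?m"
  have XYZWnz: "X \<noteq> 0" "Y \<noteq> 0" "Z \<noteq> 0" "W \<noteq> 0" using nz by (simp_all add: XYZW)
  define G where "G = qpoch (a * p ^ 2) (p ^ 2) n * qpoch (b * P ^ 2) (P ^ 2) n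
             * qpoch (c * R ^ 2) (R ^ 2) n * qpoch (a * Q ^ 2 / (b * c)) (Q ^ 2) n"
  define g where "g = (1 - a * X ^ 2) * (1 - b * Y ^ 2) * (1 - c * W ^ 2) * (1 - a / (b * c) * Z ^ 2)"
  define e where "e = (1 - Y * Z * W / X) * (1 - a / c * (X * Y * Z / W)) * (1 - a / b * (X * Z * W / Y)) * (1 - b * c * (X * Y * W / Z))"
  define h where "h = (1 - a * X * Y * Z * W) * (1 - b * (X * Y / (Z * W))) * (1 - Y * Z / (c * X * W)) * (1 - a * X * Z / (b * c * Y * W))"
  have D: "D ?m = D n * e"
    unfolding D_def e_def qpoch_Suc XYZW
    by (simp add: power_mult_distrib power_divide mult_ac)
  have Dnz: "D n \<noteq> 0" "e \<noteq> 0" using den D by auto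
  have sq: "x * u ^ 2 * (u ^ 2) ^ n = x * (u ^ ?m) ^ 2" for x u :: complex
    by (simp add: power_mult_distrib power_mult[symmetric] mult_ac)
  have sq': "x * u ^ 2 / v * (u ^ 2) ^ n = x / v * (u ^ ?m) ^ 2" for x u v :: complex
    by (simp add: power_mult_distrib power_mult[symmetric] mult_ac)
  have B: "B ?m = G * g / (D n * e)" "B n = G / D n"
    unfolding B_def D qpoch_Suc sq sq' by (simp_all add: G_def g_def XYZW mult_ac)
  \<comment> \<open>Splitting off first factors expresses the unshifted numerator of
    \<open>\<beta>\<close> through the shifted numerator \<open>G\<close> of
    \<open>B\<close>.\<close>
  have num: "qpoch a (p ^ 2) ?m * qpoch b (P ^ 2) ?m * qpoch c (R ^ 2) ?m * qpoch (a / (b * c)) (Q ^ 2) ?m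
     = (1 - a) * (1 - b) * (1 - c) * (1 - a / (b * c)) * G"
    unfolding qpoch_Suc_left by (simp add: G_def)
  \<comment> \<open>The splitting yields \<open>1 - c\<close>, whereas \<open>\<beta>\<close>
    divides by \<open>1 - 1 / c\<close>; this is the origin of the factor
    \<open>- c\<close>.\<close>
  have "1 - c = - c * (1 - 1 / c)" using nz by (simp add: field_simps)
  then have num': "(1 - a) * (1 - b) * (1 - c) * (1 - a / (b * c)) * G
    = ((1 - a) * (1 - b) * (1 - 1 / c) * (1 - a / (b * c))) * (- c * G)"
    by (simp only: ac_simps)
  have cancel: "h / u * (u * v * w / d) = h * v * w / d" if "u \<noteq> 0" for h u v w d :: complex
    using that by simp
  have "\<beta> ?m = h / ((1 - a) * (1 - b) * (1 - 1 / c) * (1 - a / (b * c)))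
     * ((1 - a) * (1 - b) * (1 - 1 / c) * (1 - a / (b * c)) * (- c * G) * W ^ 2 / (D n * e))"
    unfolding \<beta>_def num num' D h_def XYZW power_mult[symmetric] mult.commute[of _ 2] ..
  also have "\<dots> = h * (- c * G) * W ^ 2 / (D n * e)"
    using pre by (rule cancel)
  finally have \<beta>: "\<beta> ?m = G * (- c * W ^ 2 * h) / (D n * e)" by (simp add: mult_ac)
  have "g - e = - c * W ^ 2 * h"
    unfolding g_def e_def h_def using quadribasic_identity[OF XYZWnz nz(5,6)] .
  then have "\<beta> ?m = G * (g - e) / (D n * e)" using \<beta> by simp
  then show ?thesis unfolding B using Dnz by (simp add: field_simps)
qed

text \<open>This is the quadribasic identity at \<open>X = Y = Z = W\<close> with
  \<open>s = X ^ 2\<close>; the direct proof requires no square root of \<open>s\<close>.\<close>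

lemma one_base_identity:
  fixes a b c s :: "'a::field"
  assumes "b \<noteq> 0" "c \<noteq> 0"
  shows "(1 - a * s) * (1 - b * s) * (1 - c * s) * (1 - a / (b * c) * s)
     - (1 - a / c * s) * (1 - a / b * s) * (1 - b * c * s) * (1 - s)
    = (1 - b) * (1 - c) * (1 - a / (b * c)) * s * (1 - a * s ^ 2)"
  using assms by (simp add: field_simps) algebra

text \<open>Runs parallel to \<open>quadribasic_step\<close>, but \<open>1 - b\<close>,
  \<open>1 - c\<close> and \<open>1 - a / (b * c)\<close> stay in the numerator, so they are allowed
  to vanish.\<close>

lemma one_base_step:
  fixes a b c t sqa :: complex
  assumes nz: "b \<noteq> 0" "c \<noteq> 0" and a: "sqa ^ 2 = a" "1 - a \<noteq> 0"
    and den: "qpochs [sqa, - sqa, a / c * t, a / b * t, b * c * t, t] t (Suc n) \<noteq> 0"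
  defines "B \<equiv> \<lambda>n. qpochs [a * t, b * t, c * t, a * t / (b * c)] t n
             / qpochs [a / c * t, a / b * t, b * c * t, t] t n"
  defines "\<beta> \<equiv> \<lambda>n. qpochs [t * sqa, - t * sqa, a, b, c, a / (b * c)] t n * t ^ n
             / qpochs [sqa, - sqa, a / c * t, a / b * t, b * c * t, t] t n"
  shows "B (Suc n) = B n + \<beta> (Suc n)"
proof -
  let ?m = "Suc n"
  define s where "s = t ^ ?m"
  define G where "G = qpochs [a * t, b * t, c * t, a * t / (b * c)] t n"
  define D where "D = qpochs [a / c * t, a / b * t, b * c * t, t] t n"
  define g where "g = (1 - a * s) * (1 - b * s) * (1 - c * s) * (1 - a / (b * c) * s)"
  define e where "e = (1 - a / c * s) * (1 - a / b * s) * (1 - b * c * s) * (1 - s)"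
  have D: "qpochs [a / c * t, a / b * t, b * c * t, t] t ?m = D * e"
    by (simp add: D_def e_def qpoch_Suc s_def mult_ac)
  have Dnz: "D \<noteq> 0" "e \<noteq> 0" using den D by auto
  have B: "B ?m = G * g / (D * e)" "B n = G / D"
    unfolding B_def D by (simp_all add: G_def D_def g_def qpoch_Suc s_def mult_ac)
  have num: "qpochs [a, b, c, a / (b * c)] t ?m = (1 - a) * ((1 - b) * (1 - c) * (1 - a / (b * c)) * G)"
    by (simp add: qpoch_Suc_left G_def mult_ac)
  have "\<beta> ?m = qpoch (t * sqa) t ?m * qpoch (- t * sqa) t ?m / (qpoch sqa t ?m * qpoch (- sqa) t ?m)
      * (qpochs [a, b, c, a / (b * c)] t ?m * s / qpochs [a / c * t, a / b * t, b * c * t, t] t ?m)"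
    unfolding \<beta>_def s_def by (simp add: mult_ac)
  \<comment> \<open>The denominator \<open>1 - a\<close> left by the square-root pair will cancel
    the first factor of \<open>qpoch a t ?m\<close>.\<close>
  also have "\<dots> = (1 - a * t ^ (2 * ?m)) / (1 - a)
      * (((1 - a) * ((1 - b) * (1 - c) * (1 - a / (b * c)) * G)) * s / (D * e))"
    unfolding num D using den by (subst qpoch_sqrt_ratio[OF a]) auto
  also have "\<dots> = (1 - a * s ^ 2) * ((1 - b) * (1 - c) * (1 - a / (b * c)) * G) * s / (D * e)"
    using a(2) unfolding s_def by (simp add: power_mult[symmetric] mult.commute[of _ 2] del: power_Suc)
  also have "\<dots> = G * (g - e) / (D * e)"
    unfolding g_def e_def one_base_identity[OF nz] by (simp only: ac_simps)
  finally show ?thesis unfolding B using Dnz by (simp add: field_simps)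
qed

section \<open>Specialisation to terminating sums and conclusion\<close>

text \<open>Apply \<open>well_poised_telescope\<close> to \<open>y, z, w, v\<close> with
  \<open>w = k ^ 2 * q ^ N / (y * z)\<close> and \<open>v = q powi (- int N)\<close>. What remains
  is to identify its constant with \<open>C\<close> and to supply the nonvanishing
  conditions.\<close>

lemma very_well_poised_telescope:
  fixes N :: nat and q k y z sqk :: complex
  assumes N: "N > 0" and root: "sqk ^ 2 = k"
    and nonzero: "q \<noteq> 0" "k \<noteq> 0" "y \<noteq> 0" "z \<noteq> 0"
    and den_left: "\<forall>n\<le>N. qpochs [sqk, -sqk, q * k / y, q * k / z,
          y * z * q powi (1 - int N) / k, k * q ^ (1 + N)] q n \<noteq> 0"
    and den_right: "\<forall>n\<le>N. qpochs [k / y, k / z, k * q ^ N, y * z * q powi (- int N) / k] q n \<noteq> 0"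
    and den_prefactor:
      "(1 - k) * (1 - k / (y * z)) * (1 - k * q ^ N / y) * (1 - k * q ^ N / z) \<noteq> 0"
  defines "V \<equiv> \<lambda>n. qpochs [y, z, k ^ 2 * q ^ N / (y * z), q powi (- int N)] q n
          / qpochs [k / y, k / z, k * q ^ N, y * z * q powi (- int N) / k] q n"
  defines "C \<equiv> (1 - k / y) * (1 - k / z) * (1 - k * q ^ N) * (1 - k * q ^ N / (y * z))
        / ((1 - k) * (1 - k / (y * z)) * (1 - k * q ^ N / y) * (1 - k * q ^ N / z))"
  assumes n: "n \<le> N"
  shows "qpochs [q * sqk, - q * sqk, y, z, k ^ 2 * q ^ N / (y * z), q powi (- int N)] q n
          / qpochs [sqk, -sqk, q * k / y, q * k / z,
                    y * z * q powi (1 - int N) / k, k * q ^ (1 + N)] q n * q ^ n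
    = C * (V n - V (Suc n))"
proof -
  define r where "r = q ^ N"
  have r: "r \<noteq> 0" using nonzero by (simp add: r_def)
  have pw: "q powi (- int N) = 1 / r"
    by (simp add: r_def power_int_minus field_simps)
  have pw1: "q powi (1 - int N) = q / r"
    using nonzero by (simp add: r_def power_int_diff)
  define w where "w = k ^ 2 * r / (y * z)"
  define v where "v = 1 / r"
  have kw: "k / w = y * z / (k * r)" and kv: "k / v = k * r"
    using nonzero r by (simp_all add: w_def v_def field_simps power2_eq_square)
  have d: "k / y * q = q * k / y" "k / z * q = q * k / z"
    "k / w * q = y * z * q powi (1 - int N) / k" "k / v * q = k * q ^ (1 + N)"
    "k / w = y * z * q powi (- int N) / k"
    unfolding kw kv pw pw1 by (simp_all add: r_def)
  have prod: "y * z * w * v = k ^ 2" using nonzero r by (simp add: w_def v_def)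
  define E where "E = y + z + w + v - k / y - k / z - k / w - k / v"
  \<comment> \<open>The balance condition makes \<open>E\<close> factor; up to a nonzero monomial,
    the factors are those of the denominator of \<open>C\<close> other than \<open>1 - k\<close>, so
    \<open>den_prefactor\<close> gives \<open>E \<noteq> 0\<close>.\<close>
  have E: "E = - (y * z / (k * r)) * ((1 - k / (y * z)) * (1 - k * r / y) * (1 - k * r / z))"
    unfolding E_def kw kv unfolding w_def v_def using nonzero r
    by (simp add: field_simps) algebra
  have Enz: "E \<noteq> 0" using den_prefactor nonzero r unfolding E r_def[symmetric] by simp
  have k1: "1 - k \<noteq> 0" using den_prefactor by simp
  \<comment> \<open>For \<open>n = N\<close> the length \<open>Suc n\<close> exceeds the range of
    \<open>den_right\<close>. The first factor comes from \<open>den_right\<close> at index 1, the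
    other \<open>n\<close> factors from \<open>den_left\<close>.\<close>
  have nzx: "qpoch (k / x) q (Suc n) \<noteq> 0"
    if "qpoch (k / x) q 1 \<noteq> 0" "qpoch (k / x * q) q n \<noteq> 0" for x
    using that unfolding qpoch_Suc_left by (simp add: qpoch_Suc)
  \<comment> \<open>Index 1 is in range because \<open>N > 0\<close>.\<close>
  have R1: "qpochs [k / y, k / z, k / v, k / w] q 1 \<noteq> 0"
    using den_right[rule_format, of 1] N unfolding d(5) kv r_def by simp
  have Ln: "qpochs [sqk, - sqk, k / y * q, k / z * q, k / w * q, k / v * q] q n \<noteq> 0"
    using den_left n unfolding d(1-4) by blast
  have dens: "qpoch (k / y) q (Suc n) \<noteq> 0" "qpoch (k / z) q (Suc n) \<noteq> 0"
      "qpoch (k / w) q (Suc n) \<noteq> 0" "qpoch (k / v) q (Suc n) \<noteq> 0"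
    using R1 Ln by (intro nzx; simp)+
  have V: "V m = qpochs [y, z, w, v] q m / qpochs [k / y, k / z, k / w, k / v] q m" for m
    unfolding V_def kw kv pw unfolding w_def v_def r_def by (simp add: mult_ac)
  \<comment> \<open>The monomial is the same as in \<open>E\<close>, so it cancels from the
    quotient.\<close>
  have "1 - k / w = - (y * z / (k * r)) * (1 - k * r / (y * z))"
    unfolding kw using nonzero r by (simp add: field_simps)
  then have C: "(1 - k / y) * (1 - k / z) * (1 - k / w) * (1 - k / v) / ((1 - k) * E) = C"
    unfolding C_def r_def[symmetric] E kv using nonzero r
    by (simp add: mult_ac)
  have "qpochs [q * sqk, - q * sqk, y, z, w, v] q n
      / qpochs [sqk, - sqk, k / y * q, k / z * q, k / w * q, k / v * q] q n * q ^ n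
    = qpoch (q * sqk) q n * qpoch (- q * sqk) q n / (qpoch sqk q n * qpoch (- sqk) q n)
      * q ^ n * qpochs [y, z, w, v] q n / qpochs [k / y * q, k / z * q, k / w * q, k / v * q] q n"
    by (simp add: mult_ac)
  also have "\<dots> = (1 - k * q ^ (2 * n)) / (1 - k)
      * q ^ n * qpochs [y, z, w, v] q n / qpochs [k / y * q, k / z * q, k / w * q, k / v * q] q n"
    using Ln by (subst qpoch_sqrt_ratio[OF root k1]) auto
  also have "\<dots> = C * (V n - V (Suc n))"
    unfolding well_poised_telescope[OF prod nonzero(2) k1 E_def Enz dens] C V ..
  finally show ?thesis
    unfolding d(1-4) unfolding pw w_def v_def r_def .
qed

lemma qpoch_inverse_power_eq_0:
  assumes "q \<noteq> 0"
  shows "qpoch (q powi (- int N)) q (Suc N) = 0"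
  using assms by (simp add: qpoch_Suc power_int_minus)

theorem corollary8:
  fixes N :: nat
    and P p Q q R a b c k y z sqk sqa :: complex
  assumes N: "N > 0"
    and roots: "sqk ^ 2 = k" "sqa ^ 2 = a"
    and nonzero: "q \<noteq> 0" "k \<noteq> 0" "y \<noteq> 0" "z \<noteq> 0" "b \<noteq> 0" "c \<noteq> 0"
    and den_left: "\<forall>n\<le>N. qpochs [sqk, -sqk, q * k / y, q * k / z,
          y * z * q powi (1 - int N) / k, k * q ^ (1 + N)] q n \<noteq> 0"
    and den_right: "\<forall>n\<le>N. qpochs [k / y, k / z, k * q ^ N, y * z * q powi (- int N) / k] q n \<noteq> 0"
    and den_prefactor:
      "(1 - k) * (1 - k / (y * z)) * (1 - k * q ^ N / y) * (1 - k * q ^ N / z) \<noteq> 0"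
  shows
    "(p \<noteq> 0 \<and> P \<noteq> 0 \<and> Q \<noteq> 0 \<and> R \<noteq> 0 \<and>
      (1 - a) * (1 - b) * (1 - 1 / c) * (1 - a / (b * c)) \<noteq> 0 \<and>
      (\<forall>n\<le>N. qpoch (P * Q * R / p) (P * Q * R / p) n
            * qpoch (a * p * P * Q / (c * R)) (p * P * Q / R) n
            * qpoch (a * p * Q * R / (b * P)) (p * Q * R / P) n
            * qpoch (b * c * p * P * R / Q) (p * P * R / Q) n \<noteq> 0)
      \<longrightarrow>
      (\<Sum>n=0..N.
          qpochs [q * sqk, - q * sqk, y, z, k ^ 2 * q ^ N / (y * z), q powi (- int N)] q n
          / qpochs [sqk, -sqk, q * k / y, q * k / z,
                    y * z * q powi (1 - int N) / k, k * q ^ (1 + N)] q n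
          * (qpoch (a * p ^ 2) (p ^ 2) n * qpoch (b * P ^ 2) (P ^ 2) n
             * qpoch (c * R ^ 2) (R ^ 2) n * qpoch (a * Q ^ 2 / (b * c)) (Q ^ 2) n * q ^ n
             / (qpoch (P * Q * R / p) (P * Q * R / p) n
                * qpoch (a * p * P * Q / (c * R)) (p * P * Q / R) n
                * qpoch (a * p * Q * R / (b * P)) (p * Q * R / P) n
                * qpoch (b * c * p * P * R / Q) (p * P * R / Q) n)))
      = (1 - k / y) * (1 - k / z) * (1 - k * q ^ N) * (1 - k * q ^ N / (y * z))
        / ((1 - k) * (1 - k / (y * z)) * (1 - k * q ^ N / y) * (1 - k * q ^ N / z))
        * (\<Sum>n=0..N.
          qpochs [y, z, k ^ 2 * q ^ N / (y * z), q powi (- int N)] q n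
          / qpochs [k / y, k / z, k * q ^ N, y * z * q powi (- int N) / k] q n
          * ((1 - a * p ^ n * P ^ n * Q ^ n * R ^ n)
             * (1 - b * (p ^ n * P ^ n / (Q ^ n * R ^ n)))
             * (1 - P ^ n * Q ^ n / (c * p ^ n * R ^ n))
             * (1 - a * p ^ n * Q ^ n / (b * c * P ^ n * R ^ n))
             / ((1 - a) * (1 - b) * (1 - 1 / c) * (1 - a / (b * c))))
          * (qpoch a (p ^ 2) n * qpoch b (P ^ 2) n
             * qpoch c (R ^ 2) n * qpoch (a / (b * c)) (Q ^ 2) n * R ^ (2 * n)
             / (qpoch (P * Q * R / p) (P * Q * R / p) n
                * qpoch (a * p * P * Q / (c * R)) (p * P * Q / R) n
                * qpoch (a * p * Q * R / (b * P)) (p * Q * R / P) n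
                * qpoch (b * c * p * P * R / Q) (p * P * R / Q) n))))
     \<and>
     (\<forall>m::int.
      (\<forall>n\<le>N. qpochs [a / c * q powi m, a / b * q powi m, b * c * q powi m, q powi m]
                (q powi m) n \<noteq> 0) \<and>
      (\<forall>n\<le>N. qpochs [sqa, -sqa, a / c * q powi m, a / b * q powi m, b * c * q powi m, q powi m]
                (q powi m) n \<noteq> 0)
      \<longrightarrow>
      (\<Sum>n=0..N.
          qpochs [q * sqk, - q * sqk, y, z, k ^ 2 * q ^ N / (y * z), q powi (- int N)] q n
          / qpochs [sqk, -sqk, q * k / y, q * k / z,
                    y * z * q powi (1 - int N) / k, k * q ^ (1 + N)] q n
          * (qpochs [a * q powi m, b * q powi m, c * q powi m, a * q powi m / (b * c)]
               (q powi m) n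
             / qpochs [a / c * q powi m, a / b * q powi m, b * c * q powi m, q powi m]
               (q powi m) n)
          * q ^ n)
      = (1 - k / y) * (1 - k / z) * (1 - k * q ^ N) * (1 - k * q ^ N / (y * z))
        / ((1 - k) * (1 - k / (y * z)) * (1 - k * q ^ N / y) * (1 - k * q ^ N / z))
        * (\<Sum>n=0..N.
          qpochs [y, z, k ^ 2 * q ^ N / (y * z), q powi (- int N)] q n
          / qpochs [k / y, k / z, k * q ^ N, y * z * q powi (- int N) / k] q n
          * (qpochs [q powi m * sqa, - (q powi m) * sqa, a, b, c, a / (b * c)] (q powi m) n
             * q powi (m * int n)
             / qpochs [sqa, -sqa, a / c * q powi m, a / b * q powi m, b * c * q powi m, q powi m]
               (q powi m) n)))"
proof -
  define C where "C = (1 - k / y) * (1 - k / z) * (1 - k * q ^ N) * (1 - k * q ^ N / (y * z))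
        / ((1 - k) * (1 - k / (y * z)) * (1 - k * q ^ N / y) * (1 - k * q ^ N / z))"
  define U where "U n = qpochs [q * sqk, - q * sqk, y, z, k ^ 2 * q ^ N / (y * z), q powi (- int N)] q n
          / qpochs [sqk, -sqk, q * k / y, q * k / z,
                    y * z * q powi (1 - int N) / k, k * q ^ (1 + N)] q n" for n
  define V where "V n = qpochs [y, z, k ^ 2 * q ^ N / (y * z), q powi (- int N)] q n
          / qpochs [k / y, k / z, k * q ^ N, y * z * q powi (- int N) / k] q n" for n
  have UV: "U n * q ^ n = C * (V n - V (Suc n))" if "n \<le> N" for n
    unfolding U_def V_def C_def
    by (rule very_well_poised_telescope[OF N roots(1) nonzero(1-4) den_left den_right den_prefactor that])
  have VN: "V (Suc N) = 0"
    by (simp add: V_def qpoch_inverse_power_eq_0[OF nonzero(1)])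
  \<comment> \<open>\<open>B\<close> and \<open>\<beta>\<close> stay free, so that both formulas
    follow from the same instance.\<close>
  note parts = summation_by_parts[where u = "\<lambda>n. U n * q ^ n" and V = V and C = C and N = N, OF UV _ _ VN]
  show ?thesis
    unfolding C_def[symmetric] U_def[symmetric] V_def[symmetric]
  proof (intro conjI impI allI, goal_cases)
    case 1
    then have nz: "p \<noteq> 0" "P \<noteq> 0" "Q \<noteq> 0" "R \<noteq> 0"
      and pre: "(1 - a) * (1 - b) * (1 - 1 / c) * (1 - a / (b * c)) \<noteq> 0"
      and den: "\<And>n. n \<le> N \<Longrightarrow> qpoch (P * Q * R / p) (P * Q * R / p) n
            * qpoch (a * p * P * Q / (c * R)) (p * P * Q / R) n
            * qpoch (a * p * Q * R / (b * P)) (p * Q * R / P) n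
            * qpoch (b * c * p * P * R / Q) (p * P * R / Q) n \<noteq> 0"
      by blast+
    define D where "D n = qpoch (P * Q * R / p) (P * Q * R / p) n
            * qpoch (a * p * P * Q / (c * R)) (p * P * Q / R) n
            * qpoch (a * p * Q * R / (b * P)) (p * Q * R / P) n
            * qpoch (b * c * p * P * R / Q) (p * P * R / Q) n" for n
    define G where "G n = qpoch (a * p ^ 2) (p ^ 2) n * qpoch (b * P ^ 2) (P ^ 2) n
             * qpoch (c * R ^ 2) (R ^ 2) n * qpoch (a * Q ^ 2 / (b * c)) (Q ^ 2) n" for n
    define B where "B n = G n / D n" for n
    define \<beta> where "\<beta> n = ((1 - a * p ^ n * P ^ n * Q ^ n * R ^ n)
             * (1 - b * (p ^ n * P ^ n / (Q ^ n * R ^ n)))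
             * (1 - P ^ n * Q ^ n / (c * p ^ n * R ^ n))
             * (1 - a * p ^ n * Q ^ n / (b * c * P ^ n * R ^ n))
             / ((1 - a) * (1 - b) * (1 - 1 / c) * (1 - a / (b * c))))
          * (qpoch a (p ^ 2) n * qpoch b (P ^ 2) n
             * qpoch c (R ^ 2) n * qpoch (a / (b * c)) (Q ^ 2) n * R ^ (2 * n) / D n)" for n
    have step: "B (Suc n) = B n + \<beta> (Suc n)" if "n < N" for n
      unfolding B_def G_def \<beta>_def D_def
      by (rule quadribasic_step[OF nz nonzero(5,6) pre den[OF Suc_leI[OF that]]])
    have "B 0 = \<beta> 0"
      using pre by (simp add: B_def G_def \<beta>_def D_def)
    from parts[where B = B and \<beta> = \<beta>, OF _ this step]
    have "(\<Sum>n=0..N. U n * q ^ n * B n) = C * (\<Sum>n=0..N. V n * \<beta> n)" by simp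
    moreover have "U n * q ^ n * B n = U n * (G n * q ^ n / D n)" for n
      by (simp add: B_def)
    ultimately have "(\<Sum>n=0..N. U n * (G n * q ^ n / D n)) = C * (\<Sum>n=0..N. V n * \<beta> n)" by simp
    then show ?case
      unfolding G_def \<beta>_def D_def mult.assoc .
  next
    case (2 m)
    \<comment> \<open>The integer \<open>m\<close> enters only through \<open>t\<close>, and
      \<open>one_base_step\<close> allows any complex base.\<close>
    define t where "t = q powi m"
    from 2 have den: "\<And>n. n \<le> N \<Longrightarrow> qpochs [sqa, -sqa, a / c * t, a / b * t, b * c * t, t] t n \<noteq> 0"
      unfolding t_def by blast
    \<comment> \<open>At index 1, available as \<open>N > 0\<close>, the denominators reduce to
      their first factors; this yields \<open>a \<noteq> 1\<close>.\<close>
    have "1 - sqa \<noteq> 0" "1 - - sqa \<noteq> 0"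
      using den[of 1] N by (auto simp: qpoch_Suc)
    moreover have "1 - a = (1 - sqa) * (1 - - sqa)"
      by (simp add: roots(2)[symmetric] power2_eq_square algebra_simps)
    ultimately have a1: "1 - a \<noteq> 0" by simp
    define B where "B n = qpochs [a * t, b * t, c * t, a * t / (b * c)] t n
             / qpochs [a / c * t, a / b * t, b * c * t, t] t n" for n
    define \<beta> where "\<beta> n = qpochs [t * sqa, - t * sqa, a, b, c, a / (b * c)] t n * t ^ n
             / qpochs [sqa, - sqa, a / c * t, a / b * t, b * c * t, t] t n" for n
    have step: "B (Suc n) = B n + \<beta> (Suc n)" if "n < N" for n
      unfolding B_def \<beta>_def
      by (rule one_base_step[OF nonzero(5,6) roots(2) a1 den[OF Suc_leI[OF that]]])
    have "B 0 = \<beta> 0" by (simp add: B_def \<beta>_def)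
    from parts[where B = B and \<beta> = \<beta>, OF _ this step]
    have "(\<Sum>n=0..N. U n * q ^ n * B n) = C * (\<Sum>n=0..N. V n * \<beta> n)" by simp
    then have "(\<Sum>n=0..N. U n * B n * q ^ n) = C * (\<Sum>n=0..N. V n * \<beta> n)"
      by (simp add: mult_ac)
    moreover have qt: "q powi (m * int n) = t ^ n" for n
      by (simp add: t_def power_int_mult)
    ultimately show ?case
      unfolding B_def \<beta>_def t_def[symmetric] qt by simp
  qed
qed

end
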